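(* Let $H$ be a weighted graph. For every integer $n\ge 2\cdot\mathsf{v}(H)$ there is a graph $G$ on $n^2$ vertices such that $\delta_\square(G/C^G_\infty,H)\le 3\cdot\mathsf{v}(H)/n+\frac14\cdot(\mathsf{v}(H)/n)^2$.
   Context: A weighted graph $H=(V,a,B)$ has a finite vertex set $V$, positive vertex weights $a=(\alpha_v)_{v\in V}$ and a symmetric matrix $B=(\beta_{uv})\in[0,1]^{V\times V}$ of edge weights; $\mathsf{v}(H)=|V|$ and $\alpha_H=\sum_v\alpha_v$. A fractional overlay of weighted graphs $G,H$ is a matrix $X\in\mathbb{R}^{V(G)\times V(H)}$ with nonnegative entries, row sums $\sum_{v}X_{uv}=\alpha_u(G)/\alpha_G$ and column sums $\sum_uX_{uv}=\alpha_v(H)/\alpha_H$; $\mathcal{X}(G,H)$ is the set of these. For $X\in\mathcal{X}(G,H)$, $d_\square(G,H,X)=\max_{Q,R\subseteq V(G)\times V(H)}\lvert\sum_{iu\in Q,\,jv\in R}X_{iu}X_{jv}(\beta_{ij}(G)-\beta_{uv}(H))\rvert$ and the cut distance is $\delta_\square(G,H)=\min_{X\in\mathcal{X}(G,H)}d_\square(G,H,X)$. Graphs (finite, simple) are viewed as weighted graphs with unit vertex weights and $0/1$ edge weights. For a graph $G$, let $\Pi$ be the coarsest equitable partition of $V(G)$ (a partition is equitable if for all classes $C,D$ all vertices of $C$ have the same number $M^G_{CD}$ of neighbours in $D$); equivalently the partition into colour classes of the stable colouring computed by colour refinement. $G/C^G_\infty$ is the weighted graph with vertex set $\Pi$, vertex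 weights $\alpha_C=|C|$ and edge weights $\beta_{CD}=M^G_{CD}/|D|$. *)

theory Defs
  imports "HOL-Analysis.Analysis" "Graph_Theory.Pair_Digraph"
begin

section \<open>Weighted graphs\<close>

record 'a wgraph =
  wverts :: "'a set"
  vweight :: "'a \<Rightarrow> real"
  eweight :: "'a \<Rightarrow> 'a \<Rightarrow> real"

text \<open>Weights matter only on the vertex set. Diagonal edge weights may be nonzero.\<close>

definition weighted_graph :: "'a wgraph \<Rightarrow> bool" where
  "weighted_graph H \<longleftrightarrow>
     finite (wverts H) \<and>
     (\<forall>v\<in>wverts H. 0 < vweight H v) \<and>
     (\<forall>u\<in>wverts H. \<forall>v\<in>wverts H.
        0 \<le> eweight H u v \<and> eweight H u v \<le> 1 \<and> eweight H u v = eweight H v u)"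

definition total_weight :: "'a wgraph \<Rightarrow> real" where
  "total_weight H = (\<Sum>v\<in>wverts H. vweight H v)"


section \<open>Fractional overlays and the cut distance\<close>

definition overlays :: "'a wgraph \<Rightarrow> 'b wgraph \<Rightarrow> ('a \<Rightarrow> 'b \<Rightarrow> real) set" where
  "overlays G H = {X.
     (\<forall>u\<in>wverts G. \<forall>v\<in>wverts H. 0 \<le> X u v) \<and>
     (\<forall>u\<in>wverts G. (\<Sum>v\<in>wverts H. X u v) = vweight G u / total_weight G) \<and>
     (\<forall>v\<in>wverts H. (\<Sum>u\<in>wverts G. X u v) = vweight H v / total_weight H)}"

definition overlay_cut :: "'a wgraph \<Rightarrow> 'b wgraph \<Rightarrow> ('a \<Rightarrow> 'b \<Rightarrow> real) \<Rightarrow> real" where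
  "overlay_cut G H X =
     Max ((\<lambda>(Q, R). \<bar>\<Sum>(i, u)\<in>Q. \<Sum>(j, v)\<in>R.
                      X i u * X j v * (eweight G i j - eweight H u v)\<bar>) `
          (Pow (wverts G \<times> wverts H) \<times> Pow (wverts G \<times> wverts H)))"

text \<open>
  For nonempty weighted graphs the infimum below is a minimum; see
  \<open>cut_dist_attained\<close>.
\<close>

definition cut_dist :: "'a wgraph \<Rightarrow> 'b wgraph \<Rightarrow> real" where
  "cut_dist G H = (INF X\<in>overlays G H. overlay_cut G H X)"


section \<open>Equitable partitions and the quotient by the coarsest one\<close>

text \<open>
  A finite simple graph is represented by its symmetric irreflexive arc set
  (locale \<^locale>\<open>pair_graph\<close>): the edge \<open>uv\<close> contributes the two arcs
  \<open>(u, v)\<close> and \<open>(v, u)\<close>.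
\<close>

definition deg_in :: "'a pair_pre_digraph \<Rightarrow> 'a \<Rightarrow> 'a set \<Rightarrow> nat" where
  "deg_in G v D = card {w \<in> D. (v, w) \<in> parcs G}"

definition equitable :: "'a pair_pre_digraph \<Rightarrow> 'a set set \<Rightarrow> bool" where
  "equitable G P \<longleftrightarrow> partition_on (pverts G) P \<and>
     (\<forall>C\<in>P. \<forall>D\<in>P. \<forall>u\<in>C. \<forall>v\<in>C. deg_in G u D = deg_in G v D)"

text \<open>Well defined for every finite simple graph, by \<open>coarsest_equitable\<close> below.\<close>

definition stable_partition :: "'a pair_pre_digraph \<Rightarrow> 'a set set" where
  "stable_partition G =
     (THE P. equitable G P \<and> (\<forall>Q. equitable G Q \<longrightarrow> refines (pverts G) Q P))"

definition class_deg :: "'a pair_pre_digraph \<Rightarrow> 'a set \<Rightarrow> 'a set \<Rightarrow> nat" where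
  "class_deg G C D = (THE m. \<forall>v\<in>C. deg_in G v D = m)"

definition cr_quotient :: "'a pair_pre_digraph \<Rightarrow> 'a set wgraph" where
  "cr_quotient G =
     \<lparr> wverts = stable_partition G,
       vweight = (\<lambda>C. real (card C)),
       eweight = (\<lambda>C D. real (class_deg G C D) / real (card D)) \<rparr>"


section \<open>The notions are well defined\<close>

subsection \<open>The coarsest equitable partition\<close>

lemma ex_coarsest_equitable:
  assumes "pair_graph G"
  shows "\<exists>P. equitable G P \<and> (\<forall>Q. equitable G Q \<longrightarrow> refines (pverts G) Q P)"
proof -
  interpret pair_graph G by fact
  let ?V = "pverts G"
  define rel :: "'a set set \<Rightarrow> ('a \<times> 'a) set"
    where "rel Q = {(x, y). \<exists>C\<in>Q. x \<in> C \<and> y \<in> C}" for Q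
  define R where "R = (\<Union>Q\<in>{Q. equitable G Q}. rel Q)"
  have fin: "finite ?V" by (rule pair_finite_verts)
  have rel_equiv: "equiv ?V (rel Q)" if "equitable G Q" for Q
    using equiv_partition_on[of ?V Q] that by (simp add: equitable_def rel_def)
  have sing: "equitable G ((\<lambda>x. {x}) ` ?V)"
    unfolding equitable_def using partition_on_singletons[of ?V] by auto
  have R_sub: "R \<subseteq> ?V \<times> ?V"
    unfolding R_def using equiv_type[OF rel_equiv] by blast
  have R_sym: "sym R"
    unfolding R_def rel_def sym_def by blast
  have equiv: "equiv ?V (R\<^sup>+)"
  proof (rule equivI)
    show sub: "R\<^sup>+ \<subseteq> ?V \<times> ?V" by (rule trancl_subset_Sigma[OF R_sub])
    have "(x, x) \<in> R" if "x \<in> ?V" for x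
      using that sing by (auto simp: R_def rel_def)
    then show "refl_on ?V (R\<^sup>+)" by (auto simp: refl_on_def)
    show "sym (R\<^sup>+)" by (rule sym_trancl[OF R_sym])
    show "trans (R\<^sup>+)" by (rule trans_trancl)
  qed
  define P where "P = ?V // R\<^sup>+"
  have part: "partition_on ?V P"
    unfolding P_def by (rule partition_on_quotient[OF equiv])
  have sub_class: "\<exists>D\<in>P. C \<subseteq> D" if Q: "equitable G Q" and C: "C \<in> Q" for Q C
  proof -
    have pQ: "partition_on ?V Q" using Q by (simp add: equitable_def)
    obtain x where x: "x \<in> C" using pQ C by (metis partition_onD3 ex_in_conv)
    have "x \<in> ?V" using pQ C x by (auto simp: partition_on_def)
    moreover have "C \<subseteq> R\<^sup>+ `` {x}"
      using x C Q by (auto simp: R_def rel_def intro!: r_into_trancl)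
    ultimately show ?thesis unfolding P_def by (blast intro: quotientI)
  qed
  have ref: "refines ?V Q P" if "equitable G Q" for Q
    using that part sub_class by (auto simp: refines_def equitable_def)
  have step: "deg_in G u D = deg_in G v D" if uv: "(u, v) \<in> R" and D: "D \<in> P" for u v D
  proof -
    obtain Q C where Q: "equitable G Q" and C: "C \<in> Q" "u \<in> C" "v \<in> C"
      using uv by (auto simp: R_def rel_def)
    have pQ: "partition_on ?V Q" using Q by (simp add: equitable_def)
    define S where "S = {E \<in> Q. E \<subseteq> D}"
    have D_sub: "D \<subseteq> ?V" using part D by (auto simp: partition_on_def)
    have D_eq: "D = \<Union>S"
    proof
      show "D \<subseteq> \<Union>S"
      proof
        fix x assume x: "x \<in> D"
        then obtain E where E: "E \<in> Q" "x \<in> E"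
          using D_sub pQ by (auto simp: partition_on_def)
        obtain D' where D': "D' \<in> P" "E \<subseteq> D'" using sub_class[OF Q E(1)] by blast
        have "D' \<inter> D = {}" if "D' \<noteq> D"
          using part D D' that by (simp add: partition_on_def disjoint_def)
        then have "D' = D" using D' x E by blast
        then show "x \<in> \<Union>S" using E D' by (auto simp: S_def)
      qed
    qed (auto simp: S_def)
    have finE: "finite E" if "E \<in> S" for E
      using that D_sub by (auto simp: S_def intro: finite_subset[OF _ fin])
    have finS: "finite S"
      using finite_elements[OF fin pQ] by (simp add: S_def)
    have deg: "deg_in G w D = (\<Sum>E\<in>S. deg_in G w E)" for w
    proof -
      have "{x \<in> D. (w, x) \<in> parcs G} = (\<Union>E\<in>S. {x \<in> E. (w, x) \<in> parcs G})"
        using D_eq by auto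
      moreover have "card (\<Union>E\<in>S. {x \<in> E. (w, x) \<in> parcs G})
          = (\<Sum>E\<in>S. card {x \<in> E. (w, x) \<in> parcs G})"
      proof (rule card_UN_disjoint[OF finS])
        show "\<forall>E\<in>S. finite {x \<in> E. (w, x) \<in> parcs G}" using finE by auto
        show "\<forall>E\<in>S. \<forall>F\<in>S. E \<noteq> F \<longrightarrow>
            {x \<in> E. (w, x) \<in> parcs G} \<inter> {x \<in> F. (w, x) \<in> parcs G} = {}"
          using pQ by (fastforce simp: S_def partition_on_def disjoint_def)
      qed
      ultimately show ?thesis by (simp add: deg_in_def)
    qed
    have "deg_in G u E = deg_in G v E" if "E \<in> S" for E
      using Q C that unfolding equitable_def S_def by blast
    then show ?thesis by (simp add: deg)
  qed
  have "deg_in G u D = deg_in G v D" if "(u, v) \<in> R\<^sup>+" "D \<in> P" for u v D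
    using that by (induction rule: trancl_induct) (auto dest: step)
  moreover have "(u, v) \<in> R\<^sup>+" if "C \<in> P" "u \<in> C" "v \<in> C" for u v C
    using that equiv unfolding P_def by (meson quotient_eq_iff)
  ultimately have "equitable G P"
    using part unfolding equitable_def by blast
  with ref show ?thesis by blast
qed

lemma coarsest_equitable:
  assumes "pair_graph G"
  shows "\<exists>!P. equitable G P \<and> (\<forall>Q. equitable G Q \<longrightarrow> refines (pverts G) Q P)"
  using ex_coarsest_equitable[OF assms] by (metis refines_asym)

lemma stable_partition:
  assumes "pair_graph G"
  shows "equitable G (stable_partition G)"
    and "equitable G Q \<Longrightarrow> refines (pverts G) Q (stable_partition G)"
  using theI'[OF coarsest_equitable[OF assms]] unfolding stable_partition_def by blast+

lemma class_deg_eq: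
  assumes "equitable G P" "C \<in> P" "D \<in> P" "v \<in> C"
  shows "class_deg G C D = deg_in G v D"
proof -
  have "\<forall>w\<in>C. deg_in G w D = deg_in G v D"
    using assms unfolding equitable_def by blast
  then show ?thesis
    unfolding class_deg_def using \<open>v \<in> C\<close> by (intro the_equality) (blast, metis)
qed

lemma weighted_graph_cr_quotient:
  assumes "pair_graph G"
  shows "weighted_graph (cr_quotient G)"
proof -
  interpret pair_graph G by fact
  let ?P = "stable_partition G"
  note eq = stable_partition(1)[OF assms]
  have part: "partition_on (pverts G) ?P" using eq by (simp add: equitable_def)
  have finP: "finite ?P" using finite_elements[OF pair_finite_verts part] .
  have fin: "finite C" if "C \<in> ?P" for C
    using that part pair_finite_verts by (auto simp: partition_on_def intro: finite_subset)
  have ne: "C \<noteq> {}" if "C \<in> ?P" for C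
    using that part by (auto simp: partition_on_def)
  have pos: "0 < card C" if "C \<in> ?P" for C
    using fin ne that by (simp add: card_gt_0_iff)
  have arc_sym: "(x, y) \<in> parcs G \<longleftrightarrow> (y, x) \<in> parcs G" for x y
    using pair_sym_arcs by (auto simp: symmetric_def dest: symD)
  have edges: "card C * class_deg G C D = card {(x, y) \<in> C \<times> D. (x, y) \<in> parcs G}"
    if "C \<in> ?P" "D \<in> ?P" for C D
  proof -
    have "{(x, y) \<in> C \<times> D. (x, y) \<in> parcs G} = (SIGMA x:C. {y \<in> D. (x, y) \<in> parcs G})"
      by auto
    then have "card {(x, y) \<in> C \<times> D. (x, y) \<in> parcs G} = (\<Sum>x\<in>C. deg_in G x D)"
      using that fin by (simp add: card_SigmaI deg_in_def)
    also have "\<dots> = (\<Sum>x\<in>C. class_deg G C D)"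
      using class_deg_eq[OF eq that] by simp
    finally show ?thesis by simp
  qed
  have swap: "card C * class_deg G C D = card D * class_deg G D C"
    if "C \<in> ?P" "D \<in> ?P" for C D
  proof -
    have "{(x, y) \<in> D \<times> C. (x, y) \<in> parcs G} = prod.swap ` {(x, y) \<in> C \<times> D. (x, y) \<in> parcs G}"
      using arc_sym by (auto simp: image_iff)
    then have "card {(x, y) \<in> D \<times> C. (x, y) \<in> parcs G} = card {(x, y) \<in> C \<times> D. (x, y) \<in> parcs G}"
      by (simp add: card_image)
    then show ?thesis using edges that by simp
  qed
  have le: "class_deg G C D \<le> card D" if CD: "C \<in> ?P" "D \<in> ?P" for C D
  proof -
    obtain v where "v \<in> C" using ne[OF CD(1)] by blast
    then show ?thesis
      using class_deg_eq[OF eq CD] fin CD by (auto simp: deg_in_def intro: card_mono)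
  qed
  have sym: "real (class_deg G C D) / real (card D) = real (class_deg G D C) / real (card C)"
    if "C \<in> ?P" "D \<in> ?P" for C D
  proof -
    have "real (card C) * real (class_deg G C D) = real (card D) * real (class_deg G D C)"
      using swap[OF that] by (metis of_nat_mult)
    then show ?thesis using pos[OF that(1)] pos[OF that(2)] by (simp add: frac_eq_eq mult.commute)
  qed
  show ?thesis
    unfolding weighted_graph_def cr_quotient_def wgraph.simps
    using finP pos le by (intro conjI ballI sym) (simp_all add: divide_le_eq_1)
qed


subsection \<open>The minimum over fractional overlays\<close>

lemma overlays_nonempty:
  assumes "weighted_graph G" "weighted_graph H" "wverts G \<noteq> {}" "wverts H \<noteq> {}"
  shows "overlays G H \<noteq> {}"
proof -
  let ?X = "\<lambda>u v. (vweight G u / total_weight G) * (vweight H v / total_weight H)"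
  have pos: "0 < total_weight G" "0 < total_weight H"
    using assms by (auto simp: total_weight_def weighted_graph_def intro: sum_pos)
  have one: "(\<Sum>u\<in>wverts G. vweight G u / total_weight G) = 1"
    "(\<Sum>v\<in>wverts H. vweight H v / total_weight H) = 1"
    using pos by (auto simp: total_weight_def simp flip: sum_divide_distrib)
  have "?X \<in> overlays G H"
    unfolding overlays_def mem_Collect_eq sum_distrib_left[symmetric] sum_distrib_right[symmetric] one
    using assms pos by (auto simp: weighted_graph_def less_imp_le)
  then show ?thesis by blast
qed

lemma continuous_on_Max_image:
  fixes f :: "'i \<Rightarrow> 'c::topological_space \<Rightarrow> real"
  assumes "finite I" "I \<noteq> {}" "\<And>i. i \<in> I \<Longrightarrow> continuous_on S (f i)"
  shows "continuous_on S (\<lambda>x. Max ((\<lambda>i. f i x) ` I))"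
  using assms
proof (induction I rule: finite_ne_induct)
  case (insert i I)
  then have "continuous_on S (\<lambda>x. max (f i x) (Max ((\<lambda>i. f i x) ` I)))"
    by (intro continuous_on_max) auto
  then show ?case using insert by simp
qed simp

theorem cut_dist_attained:
  assumes "weighted_graph G" "weighted_graph H" "wverts G \<noteq> {}" "wverts H \<noteq> {}"
  obtains X where "X \<in> overlays G H" "cut_dist G H = overlay_cut G H X"
    and "\<And>Y. Y \<in> overlays G H \<Longrightarrow> overlay_cut G H X \<le> overlay_cut G H Y"
proof -
  let ?A = "wverts G" and ?B = "wverts H"
  have fin: "finite ?A" "finite ?B" using assms by (auto simp: weighted_graph_def)
  define S where "S p = (if p \<in> ?A \<times> ?B then {0..1} else {0::real})" for p
  define O' where "O' = {Z :: _ \<times> _ \<Rightarrow> real. curry Z \<in> overlays G H}"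
  define K where "K = PiE UNIV S \<inter> O'"
  have coord: "continuous_on T (\<lambda>Z :: _ \<times> _ \<Rightarrow> real. Z p)" for T p
    by (rule continuous_on_subset[OF continuous_on_product_coordinates]) auto
  have "compactin (product_topology (\<lambda>i. euclidean) UNIV) (PiE UNIV S)"
    by (auto simp: compactin_PiE S_def)
  then have "compact (PiE UNIV S)"
    by (simp add: euclidean_product_topology)
  moreover have "closed O'"
  proof -
    have "O' =
       (\<Inter>u\<in>?A. \<Inter>v\<in>?B. {Z. 0 \<le> Z (u, v)}) \<inter>
       (\<Inter>u\<in>?A. {Z. (\<Sum>v\<in>?B. Z (u, v)) = vweight G u / total_weight G}) \<inter>
       (\<Inter>v\<in>?B. {Z. (\<Sum>u\<in>?A. Z (u, v)) = vweight H v / total_weight H})"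
      by (auto simp: O'_def overlays_def)
    then show ?thesis
      by (simp only:)
        (intro closed_Int closed_INT ballI closed_Collect_le closed_Collect_eq
          continuous_on_const continuous_on_sum coord)
  qed
  ultimately have cpt: "compact K"
    unfolding K_def by (rule compact_Int_closed)
  have restr: "\<exists>Z\<in>K. overlay_cut G H (curry Z) = overlay_cut G H Y" if Y: "Y \<in> overlays G H" for Y
  proof -
    define Z where "Z p = (if p \<in> ?A \<times> ?B then Y (fst p) (snd p) else 0)" for p
    have eq: "curry Z u v = Y u v" if "u \<in> ?A" "v \<in> ?B" for u v
      using that by (simp add: Z_def)
    have le1: "Y u v \<le> 1" if u: "u \<in> ?A" and v: "v \<in> ?B" for u v
    proof -
      have "Y u v \<le> (\<Sum>v\<in>?B. Y u v)"
        using Y u v fin by (intro member_le_sum) (auto simp: overlays_def)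
      also have "\<dots> = vweight G u / total_weight G"
        using Y u by (simp add: overlays_def)
      also have "\<dots> \<le> 1"
      proof -
        have "vweight G u \<le> total_weight G"
          using assms u fin unfolding total_weight_def
          by (intro member_le_sum) (auto simp: weighted_graph_def less_imp_le)
        moreover have "0 < vweight G u" using assms u by (simp add: weighted_graph_def)
        ultimately show ?thesis by simp
      qed
      finally show ?thesis .
    qed
    have "curry Z \<in> overlays G H"
      using Y by (simp add: overlays_def Z_def)
    moreover have "Z \<in> PiE UNIV S"
      using Y le1 by (auto simp: PiE_def S_def Z_def overlays_def)
    moreover have "overlay_cut G H (curry Z) = overlay_cut G H Y"
      unfolding overlay_cut_def
    proof (intro arg_cong[of _ _ Max] image_cong refl, clarify)
      fix Q R assume QR: "Q \<subseteq> ?A \<times> ?B" "R \<subseteq> ?A \<times> ?B"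
      have "(\<Sum>(i, u)\<in>Q. \<Sum>(j, v)\<in>R. curry Z i u * curry Z j v * (eweight G i j - eweight H u v))
          = (\<Sum>(i, u)\<in>Q. \<Sum>(j, v)\<in>R. Y i u * Y j v * (eweight G i j - eweight H u v))"
      proof -
        have "curry Z (fst p) (snd p) = Y (fst p) (snd p)" if "p \<in> Q \<union> R" for p
          using that QR by (intro eq) auto
        then show ?thesis
          by (intro sum.cong refl) (simp add: case_prod_unfold)
      qed
      then show "\<bar>\<Sum>(i, u)\<in>Q. \<Sum>(j, v)\<in>R. curry Z i u * curry Z j v * (eweight G i j - eweight H u v)\<bar>
          = \<bar>\<Sum>(i, u)\<in>Q. \<Sum>(j, v)\<in>R. Y i u * Y j v * (eweight G i j - eweight H u v)\<bar>"
        by simp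
    qed
    ultimately show ?thesis by (auto simp: K_def O'_def)
  qed
  have "K \<noteq> {}"
    using overlays_nonempty[OF assms] restr by blast
  moreover have "continuous_on K (\<lambda>Z. overlay_cut G H (curry Z))"
    unfolding overlay_cut_def case_prod_unfold curry_def
  proof (rule continuous_on_Max_image)
    show "finite (Pow (?A \<times> ?B) \<times> Pow (?A \<times> ?B))" using fin by simp
  qed (auto simp del: curry_conv intro!: continuous_on_rabs continuous_on_sum continuous_on_mult
        continuous_on_const coord)
  ultimately obtain Z where Z: "Z \<in> K"
    and min: "\<And>Z'. Z' \<in> K \<Longrightarrow> overlay_cut G H (curry Z) \<le> overlay_cut G H (curry Z')"
    using continuous_attains_inf[OF cpt] by blast
  have mem: "curry Z \<in> overlays G H" using Z by (simp add: K_def O'_def)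
  have le: "overlay_cut G H (curry Z) \<le> overlay_cut G H Y" if "Y \<in> overlays G H" for Y
    using restr[OF that] min by force
  have "cut_dist G H = overlay_cut G H (curry Z)"
    unfolding cut_dist_def using mem le by (intro cInf_eq_minimum) auto
  then show ?thesis using that[OF mem _ le] by blast
qed

end

theory Submission
  imports Defs "HOL-Number_Theory.Cong"
begin

text \<open>
  Write \<open>k\<close> for the number of vertices of \<open>H\<close>. Arrange \<open>n\<^sup>2\<close> vertices in \<open>n\<close> slots of size \<open>n\<close> and
  give every vertex \<open>v\<close> of \<open>H\<close> an integral number of slots within 1 of its share of the total
  weight. Between the slots of \<open>u\<close> and of \<open>v\<close> put regular bipartite graphs of density
  \<open>\<rho>\<^sub>u\<^sub>v / n\<close>, where \<open>\<rho>\<^sub>u\<^sub>v / n\<close> approximates the edge weight. Inside a class there are \<open>k\<close> admissible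
  even values of \<open>\<rho>\<^sub>v\<^sub>v\<close> at distance at most \<open>2k\<close> from the ideal one, so they can be
  chosen greedily to give different classes different degrees; then colour refinement finds
  exactly these classes. Overlaying each class with its own vertex as far as the weights allow
  costs at most \<open>2k/n\<close> for the densities and \<open>k/n\<close> for the weights.
\<close>

section \<open>Discretising vertex and edge weights\<close>

text \<open>Greedy choice: the values already taken on \<open>A\<close> number at most
  \<open>card A\<close>, while the injective \<open>F a\<close> offers more than
  \<open>card A\<close> values for the new element \<open>a\<close>, so one of them is still
  free.\<close>

lemma ex_inj_on_selection:
  assumes "finite A" "\<And>v. v \<in> A \<Longrightarrow> finite (S v)" "\<And>v. v \<in> A \<Longrightarrow> card A \<le> card (S v)"
    and "\<And>v. v \<in> A \<Longrightarrow> inj_on (F v) (S v)"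
  shows "\<exists>J. (\<forall>v\<in>A. J v \<in> S v) \<and> inj_on (\<lambda>v. F v (J v)) A"
  using assms
proof (induction A rule: finite_induct)
  case (insert a A)
  have "\<exists>J. (\<forall>v\<in>A. J v \<in> S v) \<and> inj_on (\<lambda>v. F v (J v)) A"
  proof (rule insert.IH)
    show "card A \<le> card (S v)" if "v \<in> A" for v
      using insert.prems(2)[of v] insert.hyps that by simp
  qed (use insert.prems in auto)
  then obtain J where J: "\<And>v. v \<in> A \<Longrightarrow> J v \<in> S v" and inj: "inj_on (\<lambda>v. F v (J v)) A"
    by blast
  have "card (F a ` S a) = card (S a)"
    using insert.prems by (intro card_image) auto
  also have "\<dots> > card A"
    using insert.prems(2)[of a] insert.hyps by simp
  finally have "card ((\<lambda>v. F v (J v)) ` A) < card (F a ` S a)"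
    using card_image_le[OF insert.hyps(1)] le_less_trans by blast
  then have "\<not> F a ` S a \<subseteq> (\<lambda>v. F v (J v)) ` A"
    using card_mono[of "(\<lambda>v. F v (J v)) ` A" "F a ` S a"] insert.hyps by auto
  then obtain s where s: "s \<in> S a" "F a s \<notin> (\<lambda>v. F v (J v)) ` A" by blast
  let ?J = "J(a := s)"
  have eq: "?J v = J v" if "v \<in> A" for v using that insert.hyps by auto
  have "inj_on (\<lambda>v. F v (?J v)) A"
    using inj eq by (simp add: inj_on_def)
  moreover have "F a (?J a) \<notin> (\<lambda>v. F v (?J v)) ` (A - {a})"
    using s eq by auto
  ultimately have "inj_on (\<lambda>v. F v (?J v)) (insert a A)" by simp
  moreover have "\<forall>v\<in>insert a A. ?J v \<in> S v" using s J eq by auto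
  ultimately show ?case by blast
qed simp

text \<open>A half-open interval of length \<open>2 * k\<close> contains exactly \<open>k\<close>
  even integers, and as \<open>2 * k \<le> n\<close> it fits between 0 and \<open>n\<close> with
  \<open>x\<close> in its closure.\<close>

lemma ex_even_window:
  fixes x :: real
  assumes "0 < k" "2 * k \<le> n" "0 \<le> x" "x \<le> real n"
  shows "\<exists>S :: nat set. card S = k \<and> (\<forall>s\<in>S. even s \<and> s < n \<and> \<bar>real s - x\<bar> \<le> 2 * real k)"
proof -
  \<comment> \<open>Left end of the window: it starts at \<open>x\<close> unless it would then
    overshoot \<open>n\<close>, in which case it is pushed back to end at \<open>n\<close>.\<close>
  define y where "y = min x (real n - 2 * real k)"
  have y: "0 \<le> y" "y + 2 * real k \<le> real n" "y \<le> x" "x \<le> y + 2 * real k"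
  proof -
    have "2 * real k \<le> real n"
      using assms(2) by (metis of_nat_le_iff of_nat_mult of_nat_numeral)
    then show "0 \<le> y" "y + 2 * real k \<le> real n" "y \<le> x" "x \<le> y + 2 * real k"
      using assms by (auto simp: y_def)
  qed
  \<comment> \<open>\<open>2 * b\<close> is the least even integer that is at least
    \<open>y\<close>, so the last candidate \<open>2 * (b + k - 1)\<close> is still below
    \<open>y + 2 * k\<close>.\<close>
  define b where "b = nat \<lceil>y / 2\<rceil>"
  have b: "y / 2 \<le> real b" "real b < y / 2 + 1"
    using y(1) unfolding b_def by linarith+
  define S where "S = (\<lambda>i. 2 * (b + i)) ` {..<k}"
  have "card S = k"
    unfolding S_def by (subst card_image) (auto simp: inj_on_def)
  moreover have "even s \<and> s < n \<and> \<bar>real s - x\<bar> \<le> 2 * real k" if s: "s \<in> S" for s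
  proof -
    obtain i where i: "i < k" "s = 2 * (b + i)" using s by (auto simp: S_def)
    have "real i + 1 \<le> real k" using i(1) by linarith
    moreover have "real s = 2 * real b + 2 * real i" using i by simp
    ultimately have "y \<le> real s" "real s < y + 2 * real k" using b by linarith+
    with y i show ?thesis by auto
  qed
  ultimately show ?thesis by blast
qed

text \<open>The disjoint union of blocks of sizes \<open>m v\<close> has \<open>n\<close> elements;
  enumerate it and project to the block label.\<close>

lemma ex_fibres:
  assumes "finite V" "(\<Sum>v\<in>V. m v) = n"
  shows "\<exists>c. c ` {..<n} \<subseteq> V \<and> (\<forall>v\<in>V. card {s. s < n \<and> c s = v} = m v)"
proof -
  let ?S = "SIGMA v:V. {..<m v}"
  have "card ?S = n" "finite ?S" using assms by (simp_all add: card_SigmaI)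
  then obtain g where g: "bij_betw g {..<n} ?S"
    using ex_bij_betw_nat_finite[of ?S] by (metis atLeast0LessThan)
  have "card {s. s < n \<and> fst (g s) = v} = m v" if v: "v \<in> V" for v
  proof -
    have "g ` {s. s < n \<and> fst (g s) = v} = {x \<in> g ` {..<n}. fst x = v}"
      by auto
    also have "\<dots> = {v} \<times> {..<m v}"
      using v by (auto simp: bij_betw_imp_surj_on[OF g])
    finally have "card (g ` {s. s < n \<and> fst (g s) = v}) = m v" by simp
    moreover have "inj_on g {s. s < n \<and> fst (g s) = v}"
      by (rule inj_on_subset[OF bij_betw_imp_inj_on[OF g]]) auto
    ultimately show ?thesis by (simp add: card_image)
  qed
  moreover have "(fst \<circ> g) ` {..<n} \<subseteq> V"
    unfolding image_comp[symmetric] bij_betw_imp_surj_on[OF g] by auto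
  ultimately show ?thesis by (intro exI[of _ "fst \<circ> g"]) simp
qed

text \<open>Rounding down loses at most 1 per element, so the deficit is at most
  \<open>card V\<close> and is made up by adding 1 on a subset of that size.\<close>

lemma ex_apportionment:
  fixes a :: "'a \<Rightarrow> real"
  assumes "finite V" "\<And>v. v \<in> V \<Longrightarrow> 0 \<le> a v" "(\<Sum>v\<in>V. a v) = real n"
  shows "\<exists>m :: 'a \<Rightarrow> nat. (\<Sum>v\<in>V. m v) = n \<and> (\<forall>v\<in>V. \<bar>real (m v) - a v\<bar> \<le> 1)"
proof -
  define f where "f v = nat \<lfloor>a v\<rfloor>" for v
  have f: "real (f v) \<le> a v" "a v \<le> real (f v) + 1" if "v \<in> V" for v
    using assms(2)[OF that] unfolding f_def by linarith+
  have "real (\<Sum>v\<in>V. f v) \<le> real n"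
    using f(1) by (simp add: sum_mono flip: assms(3))
  then have le: "(\<Sum>v\<in>V. f v) \<le> n" by linarith
  have "real n \<le> (\<Sum>v\<in>V. real (f v) + 1)"
    using f(2) by (simp add: sum_mono flip: assms(3) del: sum.distrib)
  then have "real n \<le> real ((\<Sum>v\<in>V. f v) + card V)"
    by (simp add: sum.distrib)
  then have "n \<le> (\<Sum>v\<in>V. f v) + card V" by linarith
  then have "n - (\<Sum>v\<in>V. f v) \<le> card V" by linarith
  then obtain T where T: "T \<subseteq> V" "card T = n - (\<Sum>v\<in>V. f v)"
    by (meson obtain_subset_with_card_n)
  let ?m = "\<lambda>v. f v + (if v \<in> T then 1 else 0)"
  have "(\<Sum>v\<in>V. ?m v) = (\<Sum>v\<in>V. f v) + card T"
    using assms(1) T(1) by (simp add: sum.distrib sum.If_cases Int_absorb1)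
  then have "(\<Sum>v\<in>V. ?m v) = n" using T le by simp
  moreover have "\<bar>real (?m v) - a v\<bar> \<le> 1" if "v \<in> V" for v
    using f[OF that] by auto
  ultimately show ?thesis by blast
qed

section \<open>Bounding the cut distance by an almost diagonal overlay\<close>

text \<open>\<open>r\<close> gives each vertex of \<open>G\<close> its partner in \<open>H\<close>,
  and \<open>x\<close> is the weight distribution of \<open>G\<close> carried over to
  \<open>H\<close>. Keeping as much mass as possible on partner pairs leaves half the L1 distance of
  the two distributions off the diagonal. Each of the two entries in a cut term may be off the
  diagonal, so this mass counts twice.\<close>

lemma cut_dist_le:
  fixes G :: "'b wgraph" and H :: "'a wgraph"
  assumes G: "weighted_graph G" "wverts G \<noteq> {}" and H: "weighted_graph H" "wverts H \<noteq> {}"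
    and r: "inj_on r (wverts G)" "r ` wverts G \<subseteq> wverts H"
    and x: "\<And>i. i \<in> wverts G \<Longrightarrow> x (r i) = vweight G i / total_weight G"
      "\<And>v. v \<in> wverts H - r ` wverts G \<Longrightarrow> x v = 0"
    and d: "0 \<le> d"
      "\<And>i j. \<lbrakk>i \<in> wverts G; j \<in> wverts G\<rbrakk> \<Longrightarrow> \<bar>eweight G i j - eweight H (r i) (r j)\<bar> \<le> d"
  shows "cut_dist G H \<le> d + (\<Sum>v\<in>wverts H. \<bar>x v - vweight H v / total_weight H\<bar>)"
proof -
  let ?A = "wverts G" and ?B = "wverts H"
  have fin: "finite ?A" "finite ?B" using G H by (auto simp: weighted_graph_def)
  have pos: "0 < total_weight G" "0 < total_weight H"
    using G H by (auto simp: total_weight_def weighted_graph_def intro: sum_pos)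
  define a where "a v = vweight H v / total_weight H" for v
  define mn where "mn v = min (x v) (a v)" for v
  \<comment> \<open>The mass that cannot be matched: the excess of \<open>x\<close> over
    \<open>mn\<close> and that of \<open>a\<close> over \<open>mn\<close> both sum to
    \<open>e\<close>.\<close>
  define e where "e = 1 - (\<Sum>v\<in>?B. mn v)"
  have sum_r: "(\<Sum>i\<in>?A. g (r i)) = (\<Sum>v\<in>?B. g v)" if "\<And>v. v \<in> ?B - r ` ?A \<Longrightarrow> g v = 0" for g :: "'a \<Rightarrow> real"
  proof -
    have "(\<Sum>i\<in>?A. g (r i)) = sum g (r ` ?A)" by (simp add: sum.reindex[OF r(1)])
    also have "\<dots> = sum g ?B"
      using fin r that by (intro sum.mono_neutral_left) auto
    finally show ?thesis .
  qed
  have a1: "(\<Sum>v\<in>?B. a v) = 1"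
    using pos by (simp add: a_def total_weight_def flip: sum_divide_distrib)
  have "(\<Sum>i\<in>?A. x (r i)) = (\<Sum>v\<in>?B. x v)"
    using x(2) by (rule sum_r)
  moreover have "(\<Sum>i\<in>?A. x (r i)) = (\<Sum>i\<in>?A. vweight G i / total_weight G)"
    using x(1) by simp
  moreover have "(\<Sum>i\<in>?A. vweight G i / total_weight G) = 1"
    using pos unfolding sum_divide_distrib[symmetric] by (simp add: total_weight_def)
  ultimately have x1: "(\<Sum>v\<in>?B. x v) = 1" by metis
  have a0: "0 \<le> a v" if "v \<in> ?B" for v
    using H pos that unfolding a_def
    by (intro divide_nonneg_pos) (auto simp: weighted_graph_def less_imp_le)
  have x0: "0 \<le> x v" if v: "v \<in> ?B" for v
  proof (cases "v \<in> r ` ?A")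
    case True
    then obtain i where i: "i \<in> ?A" "v = r i" by blast
    then have "0 < vweight G i" using G by (simp add: weighted_graph_def)
    then show ?thesis using i x(1) pos by simp
  qed (use x(2) v in auto)
  have mn: "0 \<le> mn v" "mn v \<le> x v" "mn v \<le> a v" if "v \<in> ?B" for v
    using a0 x0 that by (auto simp: mn_def)
  have ex: "(\<Sum>v\<in>?B. x v - mn v) = e" and ea: "(\<Sum>v\<in>?B. a v - mn v) = e"
    by (simp_all add: sum_subtractf e_def x1 a1)
  have e0: "0 \<le> e" unfolding ex[symmetric] using mn by (intro sum_nonneg) simp
  have e_zero: "x v = mn v" "a v = mn v" if "e = 0" "v \<in> ?B" for v
  proof -
    have "\<forall>v\<in>?B. x v - mn v = 0"
      using ex that(1) fin mn by (subst sum_nonneg_eq_0_iff[symmetric]) auto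
    moreover have "\<forall>v\<in>?B. a v - mn v = 0"
      using ea that(1) fin mn by (subst sum_nonneg_eq_0_iff[symmetric]) auto
    ultimately show "x v = mn v" "a v = mn v" using that(2) by auto
  qed
  have e_abs: "(\<Sum>v\<in>?B. \<bar>x v - a v\<bar>) = 2 * e"
  proof -
    have "(\<Sum>v\<in>?B. \<bar>x v - a v\<bar>) = (\<Sum>v\<in>?B. (x v - mn v) + (a v - mn v))"
      by (intro sum.cong) (auto simp: mn_def)
    also have "\<dots> = 2 * e"
      by (simp only: sum.distrib ex ea)
    finally show ?thesis .
  qed
  \<comment> \<open>The common mass \<open>mn\<close> goes on the diagonal; the two residual
    distributions are coupled as a product, normalised by \<open>e\<close>. If \<open>e = 0\<close>,
    the quotient is 0 by convention and \<open>e_zero\<close> gives the right marginals.\<close>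
  define Y where "Y i v = (if r i = v then mn v else 0) + (x (r i) - mn (r i)) * (a v - mn v) / e" for i v
  have Y0: "0 \<le> Y i v" if "i \<in> ?A" "v \<in> ?B" for i v
    using mn that r e0 unfolding Y_def
    by (intro add_nonneg_nonneg divide_nonneg_nonneg mult_nonneg_nonneg) auto
  have row: "(\<Sum>v\<in>?B. Y i v) = x (r i)" if i: "i \<in> ?A" for i
  proof -
    have ri: "r i \<in> ?B" using i r by auto
    have "(\<Sum>v\<in>?B. Y i v) = mn (r i) + (x (r i) - mn (r i)) * e / e"
      using fin ri by (simp add: Y_def sum.distrib flip: ea sum_distrib_left sum_divide_distrib)
    also have "\<dots> = x (r i)" using e_zero[OF _ ri] by (cases "e = 0") auto
    finally show ?thesis .
  qed
  have col: "(\<Sum>i\<in>?A. Y i v) = a v" if v: "v \<in> ?B" for v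
  proof -
    let ?g = "\<lambda>u. (if u = v then mn v else 0) + (x u - mn u) * (a v - mn v) / e"
    \<comment> \<open>Off the image of \<open>r\<close>, \<open>x u\<close> and hence
      \<open>mn u\<close> are 0, so \<open>?g u\<close> vanishes there.\<close>
    have "(\<Sum>i\<in>?A. Y i v) = (\<Sum>u\<in>?B. ?g u)"
      unfolding Y_def by (rule sum_r[of ?g]) (use x(2) a0 in \<open>auto simp: mn_def\<close>)
    also have "\<dots> = mn v + e * (a v - mn v) / e"
      using fin v by (simp add: sum.distrib flip: ex sum_distrib_right sum_divide_distrib)
    also have "\<dots> = a v" using e_zero[OF _ v] by (cases "e = 0") auto
    finally show ?thesis .
  qed
  have Y: "Y \<in> overlays G H"
    using Y0 row col x(1) by (simp add: overlays_def a_def)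
  define f where "f p = (if r (fst p) = snd p then 0 else 1 :: real)" for p :: "'b \<times> 'a"
  define Z where "Z p = Y (fst p) (snd p)" for p
  have Z0: "0 \<le> Z p" if "p \<in> ?A \<times> ?B" for p using that Y0 by (auto simp: Z_def)
  have sumZ: "(\<Sum>p\<in>?A \<times> ?B. Z p) = 1"
  proof -
    have "(\<Sum>p\<in>?A \<times> ?B. Z p) = (\<Sum>i\<in>?A. \<Sum>v\<in>?B. Y i v)"
      by (simp add: sum.cartesian_product Z_def case_prod_unfold)
    also have "\<dots> = 1" using row sum_r[of x, OF x(2)] x1 by simp
    finally show ?thesis .
  qed
  \<comment> \<open>Row \<open>i\<close> has mass \<open>x (r i)\<close>, of which at least
    \<open>mn (r i)\<close> sits on the partner entry.\<close>
  have off: "(\<Sum>p\<in>?A \<times> ?B. Z p * f p) \<le> e"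
  proof -
    have "(\<Sum>p\<in>?A \<times> ?B. Z p * f p) = (\<Sum>i\<in>?A. \<Sum>v\<in>?B. Y i v * f (i, v))"
      by (simp add: sum.cartesian_product Z_def case_prod_unfold)
    also have "\<dots> \<le> (\<Sum>i\<in>?A. x (r i) - mn (r i))"
    proof (rule sum_mono)
      fix i assume i: "i \<in> ?A"
      then have ri: "r i \<in> ?B" using r by auto
      have "(\<Sum>v\<in>?B. Y i v * f (i, v)) = (\<Sum>v\<in>?B. Y i v - (if r i = v then Y i v else 0))"
        by (intro sum.cong) (auto simp: f_def)
      also have "\<dots> = x (r i) - Y i (r i)"
        using fin ri row[OF i] by (simp add: sum_subtractf)
      also have "\<dots> \<le> x (r i) - mn (r i)"
        using mn[OF ri] e0 by (simp add: Y_def)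
      finally show "(\<Sum>v\<in>?B. Y i v * f (i, v)) \<le> x (r i) - mn (r i)" .
    qed
    also have "\<dots> = e"
      unfolding ex[symmetric] by (rule sum_r) (use x(2) a0 in \<open>auto simp: mn_def\<close>)
    finally show ?thesis .
  qed
  have "overlay_cut G H Y \<le> d + 2 * e"
    unfolding overlay_cut_def
  proof (subst Max_le_iff, safe)
    fix Q R assume Q: "Q \<subseteq> ?A \<times> ?B" and R: "R \<subseteq> ?A \<times> ?B"
    let ?D = "\<lambda>p q. eweight G (fst p) (fst q) - eweight H (snd p) (snd q)"
    \<comment> \<open>For two diagonal entries the bound is \<open>d\<close>; otherwise
      \<open>f p + f q\<close> is at least 1, which bounds the difference of any two numbers in the
      unit interval.\<close>
    have D: "\<bar>?D p q\<bar> \<le> d + f p + f q" if p: "p \<in> ?A \<times> ?B" and q: "q \<in> ?A \<times> ?B" for p q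
    proof (cases "r (fst p) = snd p \<and> r (fst q) = snd q")
      case True
      then show ?thesis using d(2)[of "fst p" "fst q"] p q by (auto simp: f_def)
    next
      case False
      have "0 \<le> eweight G (fst p) (fst q)" "eweight G (fst p) (fst q) \<le> 1"
        "0 \<le> eweight H (snd p) (snd q)" "eweight H (snd p) (snd q) \<le> 1"
        using G H p q by (auto simp: weighted_graph_def)
      moreover have "1 \<le> f p + f q" using False by (auto simp: f_def)
      ultimately show ?thesis using d(1) by linarith
    qed
    have "\<bar>\<Sum>(i, u)\<in>Q. \<Sum>(j, v)\<in>R. Y i u * Y j v * (eweight G i j - eweight H u v)\<bar>
        = \<bar>\<Sum>p\<in>Q. \<Sum>q\<in>R. Z p * Z q * ?D p q\<bar>"
      by (simp add: case_prod_unfold Z_def)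
    also have "\<dots> \<le> (\<Sum>p\<in>Q. \<Sum>q\<in>R. \<bar>Z p * Z q * ?D p q\<bar>)"
      by (intro order.trans[OF sum_abs] sum_mono sum_abs)
    \<comment> \<open>All terms are now nonnegative, so \<open>Q\<close> and \<open>R\<close> may be
      enlarged to the whole product.\<close>
    also have "\<dots> \<le> (\<Sum>p\<in>?A \<times> ?B. \<Sum>q\<in>R. \<bar>Z p * Z q * ?D p q\<bar>)"
      using Q fin by (intro sum_mono2) (auto intro: sum_nonneg)
    also have "\<dots> \<le> (\<Sum>p\<in>?A \<times> ?B. \<Sum>q\<in>?A \<times> ?B. \<bar>Z p * Z q * ?D p q\<bar>)"
      using R fin by (intro sum_mono sum_mono2) auto
    also have "\<dots> \<le> (\<Sum>p\<in>?A \<times> ?B. \<Sum>q\<in>?A \<times> ?B. Z p * Z q * (d + f p + f q))"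
      using D Z0 by (intro sum_mono) (auto simp: abs_mult intro!: mult_left_mono)
    also have "\<dots> = (\<Sum>p\<in>?A \<times> ?B. \<Sum>q\<in>?A \<times> ?B. d * Z p * Z q + Z p * f p * Z q + Z p * (Z q * f q))"
      by (simp add: algebra_simps)
    \<comment> \<open>\<open>Z\<close> has total mass 1, so summing out the other entry leaves the
      off-diagonal mass once for \<open>p\<close> and once for \<open>q\<close>.\<close>
    also have "\<dots> = d + 2 * (\<Sum>p\<in>?A \<times> ?B. Z p * f p)"
      by (simp only: sum.distrib flip: sum_distrib_left sum_distrib_right) (simp add: sumZ)
    also have "\<dots> \<le> d + 2 * e" using off by simp
    finally show "\<bar>\<Sum>(i, u)\<in>Q. \<Sum>(j, v)\<in>R. Y i u * Y j v * (eweight G i j - eweight H u v)\<bar> \<le> d + 2 * e" .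
  qed (use fin in auto)
  moreover obtain X where X: "cut_dist G H = overlay_cut G H X"
    and le: "\<And>Y. Y \<in> overlays G H \<Longrightarrow> overlay_cut G H X \<le> overlay_cut G H Y"
    using cut_dist_attained[OF G(1) H(1) G(2) H(2)] by blast
  ultimately have "cut_dist G H \<le> d + 2 * e"
    using le[OF Y] by linarith
  then show ?thesis using e_abs by (simp add: a_def)
qed

section \<open>A graph with prescribed quotient\<close>

text \<open>An injective self-map of a finite set is a permutation.\<close>

lemma card_rotation_vimage:
  fixes g :: "nat \<Rightarrow> nat"
  assumes "inj_on g {..<n}" "g ` {..<n} \<subseteq> {..<n}" "S \<subseteq> {..<n}"
  shows "card {q. q < n \<and> g q \<in> S} = card S"
proof -
  have surj: "g ` {..<n} = {..<n}"
    using assms by (intro card_subset_eq) (auto simp: card_image)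
  have "g ` {q. q < n \<and> g q \<in> S} = S"
    using surj assms(3) by (auto simp: image_iff)
  moreover have "inj_on g {q. q < n \<and> g q \<in> S}"
    by (rule inj_on_subset[OF assms(1)]) auto
  ultimately show ?thesis by (metis card_image)
qed

lemma inj_on_add_mod: "inj_on (\<lambda>q. (p + q) mod n) {..<n :: nat}"
proof (rule inj_onI)
  fix q q' assume "q \<in> {..<n}" "q' \<in> {..<n}" "(p + q) mod n = (p + q') mod n"
  then show "q = q'"
    by (metis cong_def cong_add_lcancel_nat lessThan_iff mod_less)
qed

lemma card_add_mod_less:
  assumes "0 < n" "j \<le> n"
  shows "card {q. q < n \<and> (p + q) mod n < j} = j"
  using card_rotation_vimage[OF inj_on_add_mod[of p n], of "{..<j}"] assms by (auto simp: image_subset_iff)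

text \<open>Adjacency in the circulant graph on \<open>\<int>/n\<close> with connection set \<open>{\<plusminus>1, \<dots>, \<plusminus>h}\<close>.\<close>

definition circ :: "nat \<Rightarrow> nat \<Rightarrow> nat \<Rightarrow> nat \<Rightarrow> bool" where
  "circ n h p q \<longleftrightarrow> p \<noteq> q \<and> (max p q - min p q \<le> h \<or> n - h \<le> max p q - min p q)"

lemma circ_sym: "circ n h p q \<longleftrightarrow> circ n h q p"
  by (auto simp: circ_def max.commute min.commute)

lemma card_circ:
  assumes "p < n" "2 * h < n"
  shows "card {q. q < n \<and> circ n h p q} = 2 * h"
proof -
  \<comment> \<open>\<open>g q\<close> is \<open>p - q\<close> reduced modulo \<open>n\<close>. The
    neighbours of \<open>p\<close> are the \<open>q\<close> whose residue lies in
    \<open>{1..h}\<close> or \<open>{n - h..<n}\<close>, two sets that are disjoint because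
    \<open>2 * h < n\<close>.\<close>
  define g where "g q = (if q \<le> p then p - q else p + n - q)" for q
  have "inj_on g {..<n}" "g ` {..<n} \<subseteq> {..<n}"
    using assms(1) by (auto simp: g_def inj_on_def split: if_splits)
  then have "card {q. q < n \<and> g q \<in> {1..h} \<union> {n - h..<n}} = card ({1..h} \<union> {n - h..<n})"
    using assms(2) by (intro card_rotation_vimage) auto
  also have "\<dots> = 2 * h"
    using assms(2) by (subst card_Un_disjoint) auto
  also have "{q. q < n \<and> g q \<in> {1..h} \<union> {n - h..<n}} = {q. q < n \<and> circ n h p q}"
    using assms by (auto simp: g_def circ_def max_def min_def split: if_splits)
  finally show ?thesis .
qed

text \<open>
  A vertex \<open>x < n\<^sup>2\<close> is the pair \<open>(x div n, x mod n)\<close> of a slot and a residue. The slots are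
  distributed over the classes by \<open>c\<close>, and all pairs of slots of given classes carry the same
  regular bipartite graph on the residues.
\<close>

locale slot_graph =
  fixes n :: nat and c :: "nat \<Rightarrow> 'a" and \<rho> :: "'a \<Rightarrow> 'a \<Rightarrow> nat"
  assumes n_pos: "0 < n"
    and rho_sym: "\<And>u v. \<lbrakk>u \<in> c ` {..<n}; v \<in> c ` {..<n}\<rbrakk> \<Longrightarrow> \<rho> u v = \<rho> v u"
    and rho_le: "\<And>u v. \<lbrakk>u \<in> c ` {..<n}; v \<in> c ` {..<n}\<rbrakk> \<Longrightarrow> \<rho> u v \<le> n"
    and rho_diag: "\<And>u. u \<in> c ` {..<n} \<Longrightarrow> even (\<rho> u u) \<and> \<rho> u u < n"
begin

abbreviation A where "A \<equiv> c ` {..<n}"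

text \<open>Using the sum of the residues makes the relation symmetric, but it would create loops
  inside a class. There an irreflexive circulant takes over, whose degree is even; hence the parity
  condition in \<open>rho_diag\<close>.\<close>

definition adj :: "'a \<Rightarrow> 'a \<Rightarrow> nat \<Rightarrow> nat \<Rightarrow> bool" where
  "adj u v p q \<longleftrightarrow> (if u = v then circ n (\<rho> u u div 2) p q else (p + q) mod n < \<rho> u v)"

definition G :: "nat pair_pre_digraph" where
  "G = \<lparr> pverts = {..<n ^ 2},
         parcs = {(x, y). x < n ^ 2 \<and> y < n ^ 2 \<and>
           adj (c (x div n)) (c (y div n)) (x mod n) (y mod n)} \<rparr>"

definition cell :: "'a \<Rightarrow> nat set" where
  "cell v = {x. x < n ^ 2 \<and> c (x div n) = v}"

definition slots :: "'a \<Rightarrow> nat" where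
  "slots v = card {s. s < n \<and> c s = v}"

section \<open>Cells and degrees in the slot graph\<close>

lemma slot_less: "x < n ^ 2 \<Longrightarrow> x div n < n"
  using n_pos by (simp add: power2_eq_square less_mult_imp_div_less)

lemma slot_in_A: "x < n ^ 2 \<Longrightarrow> c (x div n) \<in> A"
  using slot_less by auto

lemma adj_sym: "u \<in> A \<Longrightarrow> v \<in> A \<Longrightarrow> adj u v p q \<longleftrightarrow> adj v u q p"
  using rho_sym by (auto simp: adj_def circ_sym add.commute)

lemma card_adj:
  assumes "u \<in> A" "v \<in> A" "p < n"
  shows "card {q. q < n \<and> adj u v p q} = \<rho> u v"
proof (cases "u = v")
  case True
  have "2 * (\<rho> u u div 2) = \<rho> u u" "\<rho> u u < n" using rho_diag[OF assms(1)] by auto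
  then show ?thesis using True card_circ[OF assms(3), of "\<rho> u u div 2"] by (simp add: adj_def)
next
  case False
  then show ?thesis using card_add_mod_less[OF n_pos rho_le[OF assms(1,2)]] by (simp add: adj_def)
qed

text \<open>Division with remainder by \<open>n\<close> identifies a cell with its slots times all
  residues, and \<open>R\<close> restricts only the second factor.\<close>

lemma card_cell_residues:
  "card {x \<in> cell v. R (x mod n)} = slots v * card {q. q < n \<and> R q}"
proof -
  let ?f = "\<lambda>x. (x div n, x mod n)"
  have "inj_on ?f {x \<in> cell v. R (x mod n)}"
    by (intro inj_onI) (metis Pair_inject div_mult_mod_eq)
  moreover have "?f ` {x \<in> cell v. R (x mod n)} = {s. s < n \<and> c s = v} \<times> {q. q < n \<and> R q}"
  proof (intro equalityI subsetI)
    fix y assume "y \<in> {s. s < n \<and> c s = v} \<times> {q. q < n \<and> R q}"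
    then obtain s q where y: "y = (s, q)" "s < n" "c s = v" "q < n" "R q" by auto
    have "s * n + q < (s + 1) * n" using y by simp
    also have "\<dots> \<le> n * n" using y by (intro mult_right_mono) auto
    finally have "s * n + q \<in> {x \<in> cell v. R (x mod n)}"
      using y by (simp add: cell_def power2_eq_square)
    moreover have "?f (s * n + q) = y" using y by simp
    ultimately show "y \<in> ?f ` {x \<in> cell v. R (x mod n)}" by (intro image_eqI[OF sym])
  next
    fix y assume "y \<in> ?f ` {x \<in> cell v. R (x mod n)}"
    then show "y \<in> {s. s < n \<and> c s = v} \<times> {q. q < n \<and> R q}"
      using n_pos slot_less by (auto simp: cell_def)
  qed
  ultimately have "card {x \<in> cell v. R (x mod n)} = card ({s. s < n \<and> c s = v} \<times> {q. q < n \<and> R q})"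
    using card_image[of ?f] by fastforce
  then show ?thesis by (simp add: card_cartesian_product slots_def)
qed

lemma card_cell: "card (cell v) = slots v * n"
  using card_cell_residues[of v "\<lambda>_. True"] by simp

lemma slots_pos: "v \<in> A \<Longrightarrow> 0 < slots v"
  by (auto simp: slots_def card_gt_0_iff)

lemma cell_nonempty: "v \<in> A \<Longrightarrow> cell v \<noteq> {}"
  using card_cell[of v] slots_pos[of v] n_pos by (metis card.empty mult_eq_0_iff not_gr0)

lemma pair_graph_G: "pair_graph G"
proof
  have "parcs G \<subseteq> {..<n ^ 2} \<times> {..<n ^ 2}" by (auto simp: G_def)
  then show "finite (parcs G)" by (rule finite_subset) auto
  show "symmetric G"
    using adj_sym slot_in_A by (auto simp: G_def symmetric_def intro!: symI)
  show "fst e \<noteq> snd e" if "e \<in> parcs G" for e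
    using that by (auto simp: G_def adj_def circ_def)
qed (auto simp: G_def)

text \<open>Adjacency ignores the slot within a class, so each slot of \<open>v\<close> contributes
  the same \<open>\<rho> u v\<close> neighbours.\<close>

lemma deg_in_cell:
  assumes "x \<in> cell u" "u \<in> A" "v \<in> A"
  shows "deg_in G x (cell v) = slots v * \<rho> u v"
proof -
  have "{w \<in> cell v. (x, w) \<in> parcs G} = {w \<in> cell v. adj u v (x mod n) (w mod n)}"
    using assms by (auto simp: G_def cell_def)
  then show ?thesis
    using card_cell_residues[of v "adj u v (x mod n)"] card_adj[OF assms(2,3)] n_pos
    by (simp add: deg_in_def)
qed

section \<open>The stable partition and the quotient of the slot graph\<close>

lemma partition_cells: "partition_on (pverts G) (cell ` A)"
proof (rule partition_onI)
  show "\<Union> (cell ` A) = pverts G"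
    using slot_in_A by (auto simp: cell_def G_def)
  show "disjnt C D" if "C \<in> cell ` A" "D \<in> cell ` A" "C \<noteq> D" for C D
    using that by (auto simp: cell_def disjnt_def)
qed (use cell_nonempty in auto)

lemma equitable_cells: "equitable G (cell ` A)"
  using partition_cells deg_in_cell by (auto simp: equitable_def)

lemma inj_on_cell: "inj_on cell A"
proof (rule inj_onI)
  fix u v assume "u \<in> A" "cell u = cell v"
  moreover then obtain x where "x \<in> cell u" using cell_nonempty by blast
  ultimately have "x \<in> cell u" "x \<in> cell v" by simp_all
  then show "u = v" by (simp add: cell_def)
qed

text \<open>Applied to the cells, this computes the total degree; applied to the stable partition,
  it shows that degrees are constant on its classes.\<close>

lemma deg_in_partition:
  assumes "partition_on (pverts G) P"
  shows "deg_in G x (pverts G) = (\<Sum>D\<in>P. deg_in G x D)"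
proof -
  have fin: "finite (pverts G)" by (simp add: G_def)
  have U: "\<Union>P = pverts G" using assms by (simp add: partition_on_def)
  have "{w \<in> pverts G. (x, w) \<in> parcs G} = (\<Union>D\<in>P. {w \<in> D. (x, w) \<in> parcs G})"
    using U by auto
  also have "card \<dots> = (\<Sum>D\<in>P. card {w \<in> D. (x, w) \<in> parcs G})"
  proof (rule card_UN_disjoint[OF finite_elements[OF fin assms]])
    show "\<forall>D\<in>P. finite {w \<in> D. (x, w) \<in> parcs G}"
      using U fin by (auto intro: finite_subset[of _ "pverts G"])
    show "\<forall>D\<in>P. \<forall>E\<in>P. D \<noteq> E \<longrightarrow> {w \<in> D. (x, w) \<in> parcs G} \<inter> {w \<in> E. (x, w) \<in> parcs G} = {}"
      using assms by (fastforce simp: partition_on_def disjoint_def)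
  qed
  finally show ?thesis by (simp add: deg_in_def)
qed

text \<open>
  Every class of an equitable partition consists of vertices of the same degree, so cells with
  pairwise different degrees cannot be merged.
\<close>

lemma stable_partition_G:
  assumes "inj_on (\<lambda>u. \<Sum>w\<in>A. slots w * \<rho> u w) A"
  shows "stable_partition G = cell ` A"
proof (rule refines_asym)
  note st = stable_partition[OF pair_graph_G]
  show "refines (pverts G) (cell ` A) (stable_partition G)"
    by (rule st(2)[OF equitable_cells])
  have part: "partition_on (pverts G) (stable_partition G)"
    using st(1) by (simp add: equitable_def)
  have deg: "deg_in G x (pverts G) = (\<Sum>w\<in>A. slots w * \<rho> u w)" if "x \<in> cell u" "u \<in> A" for x u
    unfolding deg_in_partition[OF partition_cells]
    using that by (simp add: sum.reindex[OF inj_on_cell] deg_in_cell)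
  have "\<exists>D\<in>cell ` A. C \<subseteq> D" if C: "C \<in> stable_partition G" for C
  proof -
    have sub: "C \<subseteq> pverts G" and "C \<noteq> {}" using part C by (auto simp: partition_on_def)
    then obtain x where x: "x \<in> C" by blast
    have cellI: "y \<in> cell (c (y div n))" "c (y div n) \<in> A" if "y \<in> C" for y
      using that sub slot_in_A by (auto simp: cell_def G_def)
    have "y \<in> cell (c (x div n))" if y: "y \<in> C" for y
    proof -
      have "deg_in G x (pverts G) = deg_in G y (pverts G)"
        unfolding deg_in_partition[OF part]
        using st(1) C x y unfolding equitable_def by (intro sum.cong refl) blast
      then have "c (x div n) = c (y div n)"
        unfolding deg[OF cellI[OF x]] deg[OF cellI[OF y]]
        by (rule inj_onD[OF assms _ cellI(2)[OF x] cellI(2)[OF y]])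
      then show ?thesis using cellI[OF y] by simp
    qed
    then show ?thesis using cellI[OF x] by blast
  qed
  then show "refines (pverts G) (stable_partition G) (cell ` A)"
    using part partition_cells by (simp add: refines_def)
qed

lemma eweight_cr_quotient_G:
  assumes "inj_on (\<lambda>u. \<Sum>w\<in>A. slots w * \<rho> u w) A" "u \<in> A" "v \<in> A"
  shows "eweight (cr_quotient G) (cell u) (cell v) = real (\<rho> u v) / real n"
proof -
  obtain x where x: "x \<in> cell u" using cell_nonempty[OF assms(2)] by blast
  have "class_deg G (cell u) (cell v) = slots v * \<rho> u v"
    using class_deg_eq[OF equitable_cells _ _ x] deg_in_cell[OF x] assms by simp
  \<comment> \<open>The factor \<open>slots v\<close> cancels between the degree into the cell and
    the size of the cell.\<close>
  then show ?thesis
    using slots_pos[OF assms(3)] by (simp add: cr_quotient_def card_cell)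
qed

lemma wverts_cr_quotient_G:
  assumes "inj_on (\<lambda>u. \<Sum>w\<in>A. slots w * \<rho> u w) A"
  shows "wverts (cr_quotient G) = cell ` A"
  by (simp add: cr_quotient_def stable_partition_G[OF assms])

lemma vweight_cr_quotient_G: "vweight (cr_quotient G) (cell u) = real (slots u * n)"
  by (simp add: cr_quotient_def card_cell)

lemma total_weight_cr_quotient_G: "total_weight (cr_quotient G) = real (n ^ 2)"
proof -
  have part: "partition_on (pverts G) (stable_partition G)"
    using stable_partition[OF pair_graph_G] by (simp add: equitable_def)
  have "(\<Sum>C\<in>stable_partition G. card C) = card (\<Union>(stable_partition G))"
    using part by (intro card_Union_disjoint[symmetric])
      (auto simp: partition_on_def disjoint_def pairwise_def disjnt_def G_def
        intro: finite_subset[of _ "{..<n ^ 2}"])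
  also have "\<Union>(stable_partition G) = pverts G" using part by (simp add: partition_on_def)
  finally show ?thesis
    by (simp add: total_weight_def cr_quotient_def G_def flip: of_nat_sum)
qed

end

section \<open>The slot graph approximating a given weighted graph\<close>

theorem theorem34:
  fixes H :: "'a wgraph" and n :: nat
  assumes "weighted_graph H" and "wverts H \<noteq> {}"
    and "n \<ge> 2 * card (wverts H)"
  shows "\<exists>G :: nat pair_pre_digraph.
           pair_graph G \<and> card (pverts G) = n ^ 2 \<and>
           cut_dist (cr_quotient G) H
             \<le> 3 * (real (card (wverts H)) / real n)
               + 1 / 4 * (real (card (wverts H)) / real n) ^ 2"
proof -
  let ?V = "wverts H"
  define k where "k = card ?V"
  have fin: "finite ?V" using assms(1) by (simp add: weighted_graph_def)
  have k: "0 < k" "2 * k \<le> n" using fin assms by (auto simp: k_def card_gt_0_iff)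
  then have n: "0 < n" by linarith
  have pos: "0 < total_weight H"
    using assms fin by (auto simp: total_weight_def weighted_graph_def intro: sum_pos)
  have beta: "0 \<le> eweight H u v" "eweight H u v \<le> 1" "eweight H u v = eweight H v u"
    if "u \<in> ?V" "v \<in> ?V" for u v
    using assms(1) that by (auto simp: weighted_graph_def)
  define a where "a v = vweight H v / total_weight H" for v
  have a0: "0 \<le> a v" if "v \<in> ?V" for v
    using assms(1) pos that unfolding a_def
    by (intro divide_nonneg_pos) (auto simp: weighted_graph_def less_imp_le)
  have "(\<Sum>v\<in>?V. a v) = 1"
    using pos by (simp add: a_def total_weight_def flip: sum_divide_distrib)
  then have "(\<Sum>v\<in>?V. real n * a v) = real n" by (simp flip: sum_distrib_left)
  then obtain m :: "'a \<Rightarrow> nat" where m: "(\<Sum>v\<in>?V. m v) = n"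
      "\<And>v. v \<in> ?V \<Longrightarrow> \<bar>real (m v) - real n * a v\<bar> \<le> 1"
    using ex_apportionment[OF fin, of "\<lambda>v. real n * a v" n] a0 by auto
  obtain c where c: "c ` {..<n} \<subseteq> ?V" "\<And>v. v \<in> ?V \<Longrightarrow> card {s. s < n \<and> c s = v} = m v"
    using ex_fibres[OF fin m(1)] by blast
  \<comment> \<open>The vertices of \<open>H\<close> that receive a slot; where
    \<open>m v = 0\<close> no cell arises, so \<open>?A\<close> may be smaller than
    \<open>?V\<close>.\<close>
  let ?A = "c ` {..<n}"
  have m_pos: "0 < m v" if "v \<in> ?A" for v
  proof -
    have "0 < card {s. s < n \<and> c s = v}" using that by (auto simp: card_gt_0_iff)
    also have "\<dots> = m v" using that c(1) by (intro c(2)) auto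
    finally show ?thesis .
  qed
  have "\<exists>S :: nat set. card S = k \<and> (\<forall>s\<in>S. even s \<and> s < n \<and> \<bar>real s - real n * eweight H v v\<bar> \<le> 2 * real k)"
    if "v \<in> ?V" for v
    using beta[OF that that] by (intro ex_even_window[OF k]) (auto simp: mult_left_le)
  then obtain S :: "'a \<Rightarrow> nat set" where S: "\<And>v. v \<in> ?V \<Longrightarrow> card (S v) = k"
      "\<And>v s. \<lbrakk>v \<in> ?V; s \<in> S v\<rbrakk> \<Longrightarrow> even s \<and> s < n \<and> \<bar>real s - real n * eweight H v v\<bar> \<le> 2 * real k"
    by metis
  define \<rho>0 where "\<rho>0 u v = nat \<lfloor>real n * eweight H u v\<rfloor>" for u v
  \<comment> \<open>The degree of the vertices in class \<open>u\<close> when its inner degree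
    parameter is \<open>s\<close>. The contributions of other classes are fixed beforehand, and
    \<open>m u > 0\<close> makes this injective in \<open>s\<close>.\<close>
  define F where "F u s = (\<Sum>w\<in>?A - {u}. m w * \<rho>0 u w) + m u * s" for u s
  have "\<exists>J. (\<forall>v\<in>?A. J v \<in> S v) \<and> inj_on (\<lambda>v. F v (J v)) ?A"
  proof (rule ex_inj_on_selection)
    fix v assume v: "v \<in> ?A"
    show "card ?A \<le> card (S v)" using v c S(1) card_mono[OF fin c(1)] by (auto simp: k_def)
    show "finite (S v)" using v c S(1)[of v] k by (auto intro: card_ge_0_finite)
    show "inj_on (F v) (S v)" using m_pos[OF v] by (auto simp: F_def inj_on_def)
  qed simp
  then obtain J where J: "\<And>v. v \<in> ?A \<Longrightarrow> J v \<in> S v" and inj: "inj_on (\<lambda>v. F v (J v)) ?A"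
    by blast
  define \<rho> where "\<rho> u v = (if u = v then J u else \<rho>0 u v)" for u v
  have rho0: "real (\<rho>0 u v) \<le> real n * eweight H u v" "real n * eweight H u v \<le> real (\<rho>0 u v) + 1"
    if "u \<in> ?V" "v \<in> ?V" for u v
    using beta(1)[OF that] mult_nonneg_nonneg[of "real n" "eweight H u v"] unfolding \<rho>0_def by linarith+
  interpret slot_graph n c \<rho>
  proof
    fix u v assume uv: "u \<in> ?A" "v \<in> ?A"
    then have V: "u \<in> ?V" "v \<in> ?V" using c by auto
    show "\<rho> u v = \<rho> v u" using beta(3)[OF V] by (simp add: \<rho>_def \<rho>0_def)
    show "\<rho> u v \<le> n"
    proof (cases "u = v")
      case True
      then show ?thesis using S(2)[OF V(1) J[OF uv(1)]] by (simp add: \<rho>_def)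
    next
      case False
      have "real (\<rho>0 u v) \<le> real n"
        using rho0(1)[OF V] beta[OF V] mult_left_le[of "eweight H u v" "real n"] by linarith
      then show ?thesis using False by (simp add: \<rho>_def)
    qed
    show "even (\<rho> u u) \<and> \<rho> u u < n" using S(2)[OF V(1) J[OF uv(1)]] by (simp add: \<rho>_def)
  qed (rule n)
  have slots: "slots v = m v" if "v \<in> ?V" for v
    using c(2)[OF that] by (simp add: slots_def)
  have "(\<Sum>w\<in>?A. slots w * \<rho> u w) = F u (J u)" if u: "u \<in> ?A" for u
  proof -
    have "(\<Sum>w\<in>?A. slots w * \<rho> u w) = slots u * \<rho> u u + (\<Sum>w\<in>?A - {u}. slots w * \<rho> u w)"
      using u by (intro sum.remove) auto
    also have "(\<Sum>w\<in>?A - {u}. slots w * \<rho> u w) = (\<Sum>w\<in>?A - {u}. m w * \<rho>0 u w)"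
      using c(1) by (intro sum.cong) (auto simp: \<rho>_def slots)
    finally show ?thesis using u c(1) slots[of u] by (auto simp: F_def \<rho>_def)
  qed
  then have inj': "inj_on (\<lambda>u. \<Sum>w\<in>?A. slots w * \<rho> u w) ?A"
    using inj by (simp cong: inj_on_cong)
  note quot = wverts_cr_quotient_G[OF inj'] eweight_cr_quotient_G[OF inj'] vweight_cr_quotient_G
    total_weight_cr_quotient_G
  let ?r = "inv_into ?A cell"
  have r_cell: "?r (cell v) = v" if "v \<in> ?A" for v
    using inv_into_f_f[OF inj_on_cell that] .
  have r_image: "?r ` cell ` ?A = ?A"
    using r_cell by (force simp: image_iff)
  \<comment> \<open>The window costs up to \<open>2 * k\<close> on the diagonal; off it, rounding
    down costs at most 1.\<close>
  have rho_approx: "\<bar>real (\<rho> u v) / real n - eweight H u v\<bar> \<le> 2 * real k / real n"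
    if "u \<in> ?A" "v \<in> ?A" for u v
  proof -
    have V: "u \<in> ?V" "v \<in> ?V" using that c by auto
    have "\<bar>real (\<rho> u v) - real n * eweight H u v\<bar> \<le> 2 * real k"
    proof (cases "u = v")
      case True
      then show ?thesis using S(2)[OF V(1) J[OF that(1)]] by (simp add: \<rho>_def)
    next
      case False
      have "1 \<le> real k" using k by simp
      then show ?thesis using False rho0[OF V] by (simp add: \<rho>_def)
    qed
    moreover have "real (\<rho> u v) / real n - eweight H u v = (real (\<rho> u v) - real n * eweight H u v) / real n"
      using n by (simp add: field_simps)
    ultimately show ?thesis by (simp add: divide_right_mono)
  qed
  have "cut_dist (cr_quotient G) H
      \<le> 2 * real k / real n + (\<Sum>v\<in>?V. \<bar>real (m v) / real n - vweight H v / total_weight H\<bar>)"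
  proof (rule cut_dist_le[where r = ?r])
    show "weighted_graph (cr_quotient G)" by (rule weighted_graph_cr_quotient[OF pair_graph_G])
    show "wverts (cr_quotient G) \<noteq> {}" using n by (auto simp: quot)
    show "inj_on ?r (wverts (cr_quotient G))" using r_cell by (auto simp: quot inj_on_def)
    show "?r ` wverts (cr_quotient G) \<subseteq> ?V" using c(1) by (simp add: quot r_image)
    fix i assume i: "i \<in> wverts (cr_quotient G)"
    then obtain u where u: "u \<in> ?A" "i = cell u" by (auto simp: quot)
    \<comment> \<open>The cell of \<open>u\<close> has \<open>m u * n\<close> of the
      \<open>n ^ 2\<close> vertices.\<close>
    show "real (m (?r i)) / real n = vweight (cr_quotient G) i / total_weight (cr_quotient G)"
      using u c(1) slots[of u] n by (auto simp: quot r_cell power2_eq_square)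
    fix j assume "j \<in> wverts (cr_quotient G)"
    then obtain v where v: "v \<in> ?A" "j = cell v" by (auto simp: quot)
    show "\<bar>eweight (cr_quotient G) i j - eweight H (?r i) (?r j)\<bar> \<le> 2 * real k / real n"
      using rho_approx[OF u(1) v(1)] u v by (simp add: quot r_cell)
  next
    fix v assume "v \<in> ?V - ?r ` wverts (cr_quotient G)"
    then have v: "v \<in> ?V" "v \<notin> ?A" by (simp_all add: quot r_image)
    then have "card {s. s < n \<and> c s = v} = 0" by auto
    then show "real (m v) / real n = 0" unfolding c(2)[OF v(1)] by simp
  qed (use assms in auto)
  \<comment> \<open>Each slot count is within 1 of the ideal share of \<open>n\<close>.\<close>
  also have "(\<Sum>v\<in>?V. \<bar>real (m v) / real n - vweight H v / total_weight H\<bar>) \<le> (\<Sum>v\<in>?V. 1 / real n)"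
  proof (rule sum_mono)
    fix v assume v: "v \<in> ?V"
    have "real (m v) / real n - a v = (real (m v) - real n * a v) / real n"
      using n by (simp add: field_simps)
    then show "\<bar>real (m v) / real n - vweight H v / total_weight H\<bar> \<le> 1 / real n"
      using m(2)[OF v] by (simp add: divide_right_mono flip: a_def)
  qed
  also have "(\<Sum>v\<in>?V. 1 / real n) = real k / real n" by (simp add: k_def)
  also have "2 * real k / real n + real k / real n = 3 * (real k / real n)" by simp
  also have "\<dots> \<le> 3 * (real k / real n) + 1 / 4 * (real k / real n) ^ 2" by simp
  finally show ?thesis
    using pair_graph_G by (intro exI[of _ G]) (simp add: G_def k_def)
qed

end
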